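(* Let $x_1,x_2>0$ be real numbers with $x_1\neq x_2$. Then the Lehmer mean function $L:\mathbb{R}\to\mathbb{R}$, $L(p)=\dfrac{x_1^p+x_2^p}{x_1^{p-1}+x_2^{p-1}}$, has exactly one inflection point, and this inflection point is $p^\star=1$.
   Context: A point $p^\star\in\mathbb{R}$ is an inflection point of the smooth function $L$ if $L''$ changes sign at $p^\star$, i.e. $L$ changes from strictly convex to strictly concave, or from strictly concave to strictly convex, at $p^\star$. *)

theory Defs
  imports "HOL-Analysis.Analysis"
begin

definition lehmer_mean :: "real \<Rightarrow> real \<Rightarrow> real \<Rightarrow> real" where
  "lehmer_mean x1 x2 p =
     (x1 powr p + x2 powr p) / (x1 powr (p - 1) + x2 powr (p - 1))"

definition smooth :: "(real \<Rightarrow> real) \<Rightarrow> bool" where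
  "smooth f \<longleftrightarrow> (\<forall>n x. (deriv ^^ n) f differentiable (at x))"

definition changes_sign_at :: "(real \<Rightarrow> real) \<Rightarrow> real \<Rightarrow> bool" where
  "changes_sign_at g p \<longleftrightarrow>
     ((\<forall>\<^sub>F q in at_left p. g q > 0) \<and> (\<forall>\<^sub>F q in at_right p. g q < 0)) \<or>
     ((\<forall>\<^sub>F q in at_left p. g q < 0) \<and> (\<forall>\<^sub>F q in at_right p. g q > 0))"

(* deriv is total, with an arbitrary value where f is not differentiable, so
   smoothness is required explicitly for the second derivative to be meaningful. *)
definition inflection_point :: "(real \<Rightarrow> real) \<Rightarrow> real \<Rightarrow> bool" where
  "inflection_point f p \<longleftrightarrow> smooth f \<and> changes_sign_at (deriv (deriv f)) p"

end

theory Submission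
  imports Defs
begin

text \<open>
  The Lehmer mean is the affine image \<open>x2 + (x1 - x2) * s\<close> of the logistic function
  \<open>s p = x1 powr (p - 1) / (x1 powr (p - 1) + x2 powr (p - 1))\<close>, which satisfies the differential
  equation \<open>s' = c * s * (1 - s)\<close> with \<open>c = ln x1 - ln x2\<close>. Hence every derivative of the mean is
  a polynomial in \<open>s\<close>, and the second one is \<open>(x1 - x2) * c\<^sup>2 * s * (1 - s) * (1 - 2 * s)\<close>.
  As \<open>(x1 - x2) * c > 0\<close>, its sign is that of \<open>1 - p\<close>.
\<close>

text \<open>Away from \<open>a\<close> the sign of \<open>g\<close> is constant on a whole
  neighbourhood of \<open>p\<close>, so both one-sided filters see the same sign; these filters are
  proper, which rules out a sign change.\<close>

lemma changes_sign_at_iff: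
  assumes pos: "\<And>q. g q > 0 \<longleftrightarrow> q < a" and neg: "\<And>q. g q < 0 \<longleftrightarrow> a < q"
  shows "changes_sign_at g p \<longleftrightarrow> p = a"
proof
  assume "p = a"
  then show "changes_sign_at g p"
    by (auto simp: changes_sign_at_def pos neg eventually_at_filter)
next
  assume *: "changes_sign_at g p"
  have not_both: False
    if "\<forall>\<^sub>F q in F. g q > 0" "\<forall>\<^sub>F q in F. g q < 0" "F \<noteq> bot" for F
  proof -
    have "\<forall>\<^sub>F q in F. False"
      using that(1,2) by eventually_elim simp
    with that(3) show False
      by simp
  qed
  show "p = a"
  proof (rule linorder_cases)
    assume "p < a"
    then have "\<forall>\<^sub>F q in nhds p. g q > 0"
      by (simp add: pos eventually_nhds_in_open[of "{..<a}", simplified])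
    then have "\<forall>\<^sub>F q in at_left p. g q > 0" "\<forall>\<^sub>F q in at_right p. g q > 0"
      by (auto simp: eventually_at_filter elim: eventually_mono)
    with * not_both show ?thesis
      unfolding changes_sign_at_def by (meson trivial_limit_at_left_real trivial_limit_at_right_real)
  next
    assume "a < p"
    then have "\<forall>\<^sub>F q in nhds p. g q < 0"
      by (simp add: neg eventually_nhds_in_open[of "{a<..}", simplified])
    then have "\<forall>\<^sub>F q in at_left p. g q < 0" "\<forall>\<^sub>F q in at_right p. g q < 0"
      by (auto simp: eventually_at_filter elim: eventually_mono)
    with * not_both show ?thesis
      unfolding changes_sign_at_def by (meson trivial_limit_at_left_real trivial_limit_at_right_real)
  qed
qed

text \<open>By the chain rule, differentiation in \<open>x\<close> becomes the operator
  \<open>P\<close> to \<open>pderiv P * Q\<close> on polynomials, which can be iterated.\<close>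

lemma has_field_derivative_poly_comp:
  assumes "\<And>x. (s has_field_derivative poly Q (s x)) (at x)"
  shows "((\<lambda>x. poly P (s x)) has_field_derivative poly (pderiv P * Q) (s x)) (at x)"
  using DERIV_chain2[OF poly_DERIV assms] by simp

lemma smooth_poly_comp:
  assumes "\<And>x. (s has_field_derivative poly Q (s x)) (at x)"
  shows "smooth (\<lambda>x. poly P (s x))"
proof -
  note D = has_field_derivative_poly_comp[OF assms]
  \<comment> \<open>Smoothness needs only that some polynomial exists at each order, so no closed
    form for \<open>R\<close> is tracked.\<close>
  have "\<exists>R. (deriv ^^ n) (\<lambda>x. poly P (s x)) = (\<lambda>x. poly R (s x))" for n
  proof (induction n)
    case (Suc n)
    then obtain R where "(deriv ^^ n) (\<lambda>x. poly P (s x)) = (\<lambda>x. poly R (s x))"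
      by blast
    then have "(deriv ^^ Suc n) (\<lambda>x. poly P (s x)) = (\<lambda>x. poly (pderiv R * Q) (s x))"
      using DERIV_imp_deriv[OF D] by auto
    then show ?case ..
  qed auto
  with D show ?thesis
    unfolding smooth_def by (metis real_differentiable_def)
qed

definition logistic_weight :: "real \<Rightarrow> real \<Rightarrow> real \<Rightarrow> real" where
  "logistic_weight x1 x2 p = x1 powr (p - 1) / (x1 powr (p - 1) + x2 powr (p - 1))"

context
  fixes x1 x2 :: real
  assumes x1: "x1 > 0" and x2: "x2 > 0"
begin

text \<open>Pulling one factor \<open>x1\<close> or \<open>x2\<close> out of each power in the
  numerator exhibits the mean as the average of \<open>x1\<close> and \<open>x2\<close> with weights
  \<open>s\<close> and \<open>1 - s\<close>.\<close>

lemma lehmer_mean_eq_logistic: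
  "lehmer_mean x1 x2 = (\<lambda>p. poly [:x2, x1 - x2:] (logistic_weight x1 x2 p))"
proof
  fix p
  have "x1 powr (p - 1) + x2 powr (p - 1) > 0"
    using x1 x2 by (intro add_pos_pos) auto
  moreover have "x1 powr p = x1 * x1 powr (p - 1)" "x2 powr p = x2 * x2 powr (p - 1)"
    using x1 x2 by (simp_all add: powr_diff)
  ultimately show "lehmer_mean x1 x2 p = poly [:x2, x1 - x2:] (logistic_weight x1 x2 p)"
    unfolding lehmer_mean_def logistic_weight_def by (simp add: field_simps)
qed

lemma has_field_derivative_logistic_weight:
  defines "c \<equiv> ln x1 - ln x2"
  shows "(logistic_weight x1 x2 has_field_derivative poly [:0, c, - c:] (logistic_weight x1 x2 p)) (at p)"
proof -
  have pos: "x1 powr (p - 1) + x2 powr (p - 1) > 0"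
    using x1 x2 by (intro add_pos_pos) auto
  show ?thesis
    unfolding logistic_weight_def using x1 x2 pos
    by (auto intro!: derivative_eq_intros simp: c_def) (simp add: field_simps)
qed

lemma logistic_weight_bounds: "0 < logistic_weight x1 x2 p" "logistic_weight x1 x2 p < 1"
proof -
  have "x1 powr (p - 1) > 0" "x2 powr (p - 1) > 0"
    using x1 x2 by auto
  then show "0 < logistic_weight x1 x2 p" "logistic_weight x1 x2 p < 1"
    unfolding logistic_weight_def by (simp_all add: add_pos_pos)
qed

text \<open>The weight is below 1/2 exactly when \<open>x1 powr (p - 1)\<close> is below
  \<open>x2 powr (p - 1)\<close>, and monotonicity of \<open>exp\<close> reduces this to comparing
  exponents.\<close>

lemma sgn_logistic_weight:
  "sgn (1 - 2 * logistic_weight x1 x2 p) = sgn ((ln x1 - ln x2) * (1 - p))"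
proof -
  have pos: "x1 powr (p - 1) + x2 powr (p - 1) > 0"
    using x1 x2 by (intro add_pos_pos) auto
  then have "1 - 2 * logistic_weight x1 x2 p
      = (x2 powr (p - 1) - x1 powr (p - 1)) / (x1 powr (p - 1) + x2 powr (p - 1))"
    unfolding logistic_weight_def by (simp add: field_simps)
  then have "sgn (1 - 2 * logistic_weight x1 x2 p) = sgn (x2 powr (p - 1) - x1 powr (p - 1))"
    using pos by simp
  also have "\<dots> = sgn ((p - 1) * ln x2 - (p - 1) * ln x1)"
    using x1 x2 by (simp add: powr_def sgn_if)
  also have "(p - 1) * ln x2 - (p - 1) * ln x1 = (ln x1 - ln x2) * (1 - p)"
    by (simp add: algebra_simps)
  finally show ?thesis .
qed

lemma sgn_deriv_deriv_lehmer_mean: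
  assumes "x1 \<noteq> x2"
  shows "sgn (deriv (deriv (lehmer_mean x1 x2)) p) = sgn (1 - p)"
proof -
  define c where "c = ln x1 - ln x2"
  define s where "s = logistic_weight x1 x2"
  \<comment> \<open>\<open>D\<close> holds for every polynomial in \<open>s\<close>, so rewriting
    with it evaluates both nested derivatives.\<close>
  note D = DERIV_imp_deriv[OF has_field_derivative_poly_comp,
      OF has_field_derivative_logistic_weight, folded c_def s_def]
  \<comment> \<open>The two factors \<open>c\<close> are separated so that each block has a known
    sign: the first is positive since \<open>ln\<close> is increasing, the second since
    \<open>s\<close> lies strictly between 0 and 1, and the third has the sign of
    \<open>c * c * (1 - p)\<close>.\<close>
  have eq: "deriv (deriv (lehmer_mean x1 x2)) p
      = ((x1 - x2) * c) * (s p * (1 - s p)) * (c * (1 - 2 * s p))"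
    unfolding lehmer_mean_eq_logistic s_def[symmetric] D
    by (simp add: pderiv_pCons algebra_simps)
  have sgn_c: "sgn c = sgn (x1 - x2)"
    using x1 x2 by (simp add: c_def sgn_if)
  have "sgn ((x1 - x2) * c) = 1"
    unfolding sgn_mult sgn_c using assms by (simp add: sgn_if)
  moreover have "sgn (s p * (1 - s p)) = 1"
    using logistic_weight_bounds[of p] by (simp add: s_def sgn_mult)
  moreover have "sgn (c * (1 - 2 * s p)) = sgn c * sgn c * sgn (1 - p)"
    using sgn_logistic_weight[of p] by (simp add: s_def c_def sgn_mult)
  moreover have "sgn c * sgn c = 1"
    unfolding sgn_c using assms by (simp add: sgn_if)
  ultimately show ?thesis
    \<comment> \<open>The instantiations split \<open>sgn\<close> only between the three blocks and
      keep each block intact.\<close>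
    unfolding eq sgn_mult[of "_ * (s p * (1 - s p))"] sgn_mult[of "_ * c"] by simp
qed

lemma inflection_point_lehmer_mean_iff:
  assumes "x1 \<noteq> x2"
  shows "inflection_point (lehmer_mean x1 x2) p \<longleftrightarrow> p = 1"
proof -
  note sgn = sgn_deriv_deriv_lehmer_mean[OF assms]
  have "smooth (lehmer_mean x1 x2)"
    unfolding lehmer_mean_eq_logistic
    by (rule smooth_poly_comp[OF has_field_derivative_logistic_weight])
  moreover have "changes_sign_at (deriv (deriv (lehmer_mean x1 x2))) p \<longleftrightarrow> p = 1"
  proof (rule changes_sign_at_iff)
    fix q
    show "deriv (deriv (lehmer_mean x1 x2)) q > 0 \<longleftrightarrow> q < 1"
      using sgn[of q] by (metis diff_gt_0_iff_gt sgn_greater)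
    show "deriv (deriv (lehmer_mean x1 x2)) q < 0 \<longleftrightarrow> 1 < q"
      using sgn[of q] by (metis diff_less_0_iff_less sgn_less)
  qed
  ultimately show ?thesis
    by (simp add: inflection_point_def)
qed

end

theorem mainTheorem1:
  fixes x1 x2 :: real
  assumes "x1 > 0" and "x2 > 0" and "x1 \<noteq> x2"
  shows "(\<exists>!p. inflection_point (lehmer_mean x1 x2) p) \<and>
         inflection_point (lehmer_mean x1 x2) 1"
  using inflection_point_lehmer_mean_iff[OF assms] by simp

end
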